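(* There exists a skew-Hadamard matrix of order $1252=2(5^4+1)$.
   Context: A skew-Hadamard matrix of order $n$ is an $n\times n$ matrix $H$ with entries in $\{+1,-1\}$ satisfying $HH^T=nI_n$ and $H+H^T=2I_n$ (equivalently, $H-I_n$ is skew-symmetric). *)

theory Defs
  imports "Jordan_Normal_Form.Matrix"
begin

definition hadamard_mat :: "nat \<Rightarrow> int mat \<Rightarrow> bool" where
  "hadamard_mat n H \<longleftrightarrow>
     H \<in> carrier_mat n n \<and>
     elements_mat H \<subseteq> {1, -1} \<and>
     H * transpose_mat H = int n \<cdot>\<^sub>m 1\<^sub>m n"

definition skew_hadamard_mat :: "nat \<Rightarrow> int mat \<Rightarrow> bool" where
  "skew_hadamard_mat n H \<longleftrightarrow>
     hadamard_mat n H \<and> H + transpose_mat H = 2 \<cdot>\<^sub>m 1\<^sub>m n"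

end

theory Submission
  imports Defs "HOL-Computational_Algebra.Primes" "HOL-Library.Numeral_Type" "HOL-Library.Product_Plus"
begin

text \<open>Let \<open>g\<close> be a primitive element of the field \<open>K\<close> with 625 elements and put
  \<open>U (g ^ k) = \<i> ^ (k div 4)\<close>, \<open>U 0 = 0\<close>; this is well defined because 16 divides 624.
  Computing the autocorrelation \<open>C d\<close> of \<open>U\<close> at \<open>d = g ^ s\<close> as a sum over \<open>x\<close> of
  \<open>U (g ^ s * x) * cnj (U (g ^ s * (x + 1)))\<close>, the substitution \<open>x \<mapsto> x ^ 5\<close> multiplies the term
  of \<open>x\<close> by \<open>\<chi> x * cnj (\<chi> (x + 1))\<close>, where \<open>\<chi>\<close> is the quartic character. Hence only those \<open>x\<close>
  with \<open>\<chi> x = \<chi> (x + 1)\<close> contribute, and their terms do not depend on \<open>s\<close>. So \<open>C\<close> is constant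
  on nonzero elements, and as the values of \<open>U\<close> sum to 0 the constant is \<open>-1\<close>. The functions
  \<open>Re U - Im U\<close> and \<open>Re U + Im U\<close> are odd, have values \<open>1, -1\<close> away from 0, and their
  autocorrelations add up to \<open>2 * Re C = -2\<close>: a pair of the kind that Szekeres' array turns
  into a skew-Hadamard matrix.\<close>

section \<open>From functions on an abelian group to skew-Hadamard matrices\<close>

text \<open>Rows and columns are enumerated by the same bijection, so skewness carries over and
  block matrices may be indexed by a structured type.\<close>

lemma skew_hadamard_mat_of_finite_type:
  fixes h :: "'b::finite \<Rightarrow> 'b \<Rightarrow> int"
  assumes entries: "\<And>x y. h x y = 1 \<or> h x y = -1"
    and rows: "\<And>x y. (\<Sum>z\<in>UNIV. h x z * h y z) = (if x = y then int CARD('b) else 0)"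
    and skew: "\<And>x y. h x y + h y x = (if x = y then 2 else 0)"
  shows "\<exists>H. skew_hadamard_mat CARD('b) H"
proof -
  let ?n = "CARD('b)"
  obtain f :: "nat \<Rightarrow> 'b" where f: "bij_betw f {0..<?n} UNIV"
    using ex_bij_betw_nat_finite[of "UNIV :: 'b set"] by auto
  have f_eq: "f i = f j \<longleftrightarrow> i = j" if "i < ?n" "j < ?n" for i j
    using f that by (auto simp: bij_betw_def inj_on_def)
  define H where "H = mat ?n ?n (\<lambda>(i, j). h (f i) (f j))"
  have "(\<Sum>k = 0..<?n. h (f i) (f k) * h (f j) (f k)) = (if i = j then int ?n else 0)"
    if "i < ?n" "j < ?n" for i j
    using sum.reindex_bij_betw[OF f, of "\<lambda>z. h (f i) z * h (f j) z"] rows f_eq[OF that] by simp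
  then have "H * transpose_mat H = int ?n \<cdot>\<^sub>m 1\<^sub>m ?n"
    by (intro eq_matI) (auto simp: H_def scalar_prod_def)
  moreover have "elements_mat H \<subseteq> {1, -1}"
    using entries by (auto simp: elements_mat_def H_def)
  moreover have "H + transpose_mat H = 2 \<cdot>\<^sub>m 1\<^sub>m ?n"
    using skew f_eq by (intro eq_matI) (auto simp: H_def)
  ultimately show ?thesis
    by (auto simp: skew_hadamard_mat_def hadamard_mat_def H_def intro!: exI[of _ H])
qed

lemma sum_UNIV_option: "(\<Sum>z\<in>UNIV. g z) = g None + (\<Sum>x\<in>UNIV. g (Some x))"
  for g :: "'a::finite option \<Rightarrow> int"
  by (simp add: UNIV_option_conv sum.reindex)

lemma sum_UNIV_bool_prod:
  "(\<Sum>z\<in>UNIV. g z) = (\<Sum>x\<in>UNIV. g (False, x)) + (\<Sum>x\<in>UNIV. g (True, x))"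
  for g :: "bool \<times> 'a::finite \<Rightarrow> int"
proof -
  have "(\<Sum>z\<in>UNIV. g z) = (\<Sum>s\<in>UNIV. \<Sum>x\<in>UNIV. g (s, x))"
    by (simp add: sum.cartesian_product)
  then show ?thesis by (simp add: UNIV_bool)
qed

lemma sum_UNIV_translate: "(\<Sum>z\<in>UNIV. g (z + d)) = (\<Sum>z\<in>UNIV. g z)"
  for d :: "'a::{ab_group_add,finite}"
  by (rule sum.reindex_bij_witness[of _ "\<lambda>z. z - d" "\<lambda>z. z + d"]) auto

lemma sum_UNIV_minus: "(\<Sum>z\<in>UNIV. g (z - d)) = (\<Sum>z\<in>UNIV. g z)"
  for d :: "'a::{ab_group_add,finite}"
  by (rule sum.reindex_bij_witness[of _ "\<lambda>z. z + d" "\<lambda>z. z - d"]) auto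

text \<open>With \<open>A = (a (y - x))\<close>, \<open>B = (b (x + y))\<close> and \<open>+\<close>, \<open>-\<close> denoting entries or constant vectors
  of that sign, and the indices grouped as \<open>(False, None)\<close>, \<open>(True, None)\<close>, \<open>(False, Some _)\<close>,
  \<open>(True, Some _)\<close>, the block rows are \<open>(+ + + +)\<close>, \<open>(- + + -)\<close>, \<open>(- - A B)\<close>, \<open>(- + -B A)\<close>.
  Taking \<open>B\<close> symmetric rather than a function of \<open>y - x\<close> avoids transposes.\<close>

fun szekeres_matrix ::
    "('a::ab_group_add \<Rightarrow> int) \<Rightarrow> ('a \<Rightarrow> int) \<Rightarrow> bool \<times> 'a option \<Rightarrow> bool \<times> 'a option \<Rightarrow> int" where
  "szekeres_matrix a b (False, None) (_, _) = 1"
| "szekeres_matrix a b (True, None) (False, None) = -1"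
| "szekeres_matrix a b (True, None) (False, Some _) = 1"
| "szekeres_matrix a b (True, None) (True, None) = 1"
| "szekeres_matrix a b (True, None) (True, Some _) = -1"
| "szekeres_matrix a b (False, Some _) (_, None) = -1"
| "szekeres_matrix a b (True, Some _) (False, None) = -1"
| "szekeres_matrix a b (True, Some _) (True, None) = 1"
| "szekeres_matrix a b (False, Some x) (False, Some y) = a (y - x)"
| "szekeres_matrix a b (False, Some x) (True, Some y) = b (x + y)"
| "szekeres_matrix a b (True, Some x) (False, Some y) = - b (x + y)"
| "szekeres_matrix a b (True, Some x) (True, Some y) = a (y - x)"

text \<open>For distinct rows of the same inner block row, the two border columns contribute 2
  against the -2 of \<open>auto\<close>; the sums 1 of \<open>a\<close> and \<open>b\<close> balance
  the border rows.\<close>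

lemma skew_hadamard_mat_of_szekeres:
  fixes a b :: "'a::{ab_group_add,finite} \<Rightarrow> int"
  assumes a: "\<And>x. a x = 1 \<or> a x = -1" and b: "\<And>x. b x = 1 \<or> b x = -1"
    and a0: "a 0 = 1" and a_odd: "\<And>x. x \<noteq> 0 \<Longrightarrow> a (- x) = - a x"
    and sum_a: "(\<Sum>x\<in>UNIV. a x) = 1" and sum_b: "(\<Sum>x\<in>UNIV. b x) = 1"
    and auto: "\<And>d. d \<noteq> 0 \<Longrightarrow> (\<Sum>z\<in>UNIV. a z * a (z + d) + b z * b (z + d)) = -2"
  shows "\<exists>H. skew_hadamard_mat (2 * (CARD('a) + 1)) H"
proof -
  let ?h = "szekeres_matrix a b"
  have sa: "(\<Sum>z\<in>UNIV. a (z - x)) = 1" for x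
    using sum_UNIV_minus[of a x] sum_a by simp
  have sb: "(\<Sum>z\<in>UNIV. b (x + z)) = 1" for x
    using sum_UNIV_translate[of b x] sum_b by (simp add: add.commute)
  have sq: "a x * a x = 1" "b x * b x = 1" for x
    using a[of x] b[of x] by auto
  have core: "(\<Sum>z\<in>UNIV. a (z - x) * a (z - y)) + (\<Sum>z\<in>UNIV. b (x + z) * b (y + z))
      = (if x = y then 2 * int CARD('a) else -2)" (is "?l = _") for x y
  proof (cases "x = y")
    case True
    then show ?thesis by (simp add: sq)
  next
    case False
    have "(\<Sum>z\<in>UNIV. a (z - x) * a (z - y)) = (\<Sum>z\<in>UNIV. a z * a (z + (x - y)))"
      using sum_UNIV_minus[of "\<lambda>z. a z * a (z + (x - y))" x] by simp
    moreover have "(\<Sum>z\<in>UNIV. b (x + z) * b (y + z)) = (\<Sum>z\<in>UNIV. b z * b (z + (x - y)))"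
      using sum_UNIV_translate[of "\<lambda>z. b z * b (z + (x - y))" y]
      by (simp add: algebra_simps)
    ultimately show ?thesis
      using auto[of "x - y"] False by (simp add: sum.distrib)
  qed
  have core': "(\<Sum>z\<in>UNIV. b (x + z) * b (y + z)) + (\<Sum>z\<in>UNIV. a (z - x) * a (z - y))
      = (if x = y then 2 * int CARD('a) else -2)" for x y
    using core[of x y] by simp
  \<comment> \<open>This is \<open>A B^T = B A^T\<close>, which makes the block rows
    \<open>(A B)\<close> and \<open>(-B A)\<close> orthogonal.\<close>
  have mixed: "(\<Sum>z\<in>UNIV. a (z - x) * b (y + z)) = (\<Sum>z\<in>UNIV. b (x + z) * a (z - y))" for x y
  proof -
    have "(\<Sum>z\<in>UNIV. a (z - x) * b (y + z)) = (\<Sum>z\<in>UNIV. a z * b (x + y + z))"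
      using sum_UNIV_minus[of "\<lambda>z. a z * b (x + y + z)" x] by (simp add: algebra_simps)
    also have "\<dots> = (\<Sum>z\<in>UNIV. b (x + z) * a (z - y))"
      using sum_UNIV_minus[of "\<lambda>z. a z * b (x + y + z)" y] by (simp add: algebra_simps)
    finally show ?thesis .
  qed
  have card: "CARD(bool \<times> 'a option) = 2 * (CARD('a) + 1)"
    by (simp add: card_UNIV_option)
  have entries: "?h x y = 1 \<or> ?h x y = -1" for x y
    using a b by (cases "(a, b, x, y)" rule: szekeres_matrix.cases) auto
  have rows: "(\<Sum>z\<in>UNIV. ?h x z * ?h y z) = (if x = y then int CARD(bool \<times> 'a option) else 0)"
    for x y
  proof -
    obtain s u t v where xy: "x = (s, u)" "y = (t, v)" by (metis surj_pair)
    show ?thesis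
    proof (cases "\<exists>p q. u = Some p \<and> v = Some q")
      case True
      then obtain p q where uv: "u = Some p" "v = Some q" by blast
      show ?thesis
        unfolding xy uv sum_UNIV_bool_prod sum_UNIV_option card
        using mixed[of p q] core[of p q] core'[of p q]
        by (cases s; cases t; cases "p = q") (simp_all add: sum_negf)
    next
      case False
      then show ?thesis
        unfolding xy sum_UNIV_bool_prod sum_UNIV_option card
        by (cases s; cases t; cases u; cases v) (simp_all add: sum_negf sa sb)
    qed
  qed
  have skew: "?h x y + ?h y x = (if x = y then 2 else 0)" for x y
  proof -
    obtain s u t v where xy: "x = (s, u)" "y = (t, v)" by (metis surj_pair)
    have "a (p - q) + a (q - p) = (if p = q then 2 else 0)" for p q
      using a_odd[of "p - q"] by (simp add: a0)
    then show ?thesis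
      unfolding xy by (cases s; cases t; cases u; cases v) (simp_all add: add.commute)
  qed
  show ?thesis
    using skew_hadamard_mat_of_finite_type[OF entries rows skew] unfolding card .
qed

text \<open>Adding the indicator of 0 raises the sums from 0 to 1 and changes the autocorrelation at
  \<open>d\<close> by \<open>f d + f (- d)\<close>, which oddness cancels.\<close>

lemma skew_hadamard_mat_of_odd_pair:
  fixes a b :: "'a::{ab_group_add,finite} \<Rightarrow> int"
  assumes a: "\<And>x. x \<noteq> 0 \<Longrightarrow> a x = 1 \<or> a x = -1" and b: "\<And>x. x \<noteq> 0 \<Longrightarrow> b x = 1 \<or> b x = -1"
    and a_odd: "\<And>x. a (- x) = - a x" and b_odd: "\<And>x. b (- x) = - b x"
    and auto: "\<And>d. d \<noteq> 0 \<Longrightarrow> (\<Sum>z\<in>UNIV. a z * a (z + d) + b z * b (z + d)) = -2"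
  shows "\<exists>H. skew_hadamard_mat (2 * (CARD('a) + 1)) H"
proof -
  define \<delta> :: "'a \<Rightarrow> int" where "\<delta> x = (if x = 0 then 1 else 0)" for x
  have sum_\<delta>: "(\<Sum>z\<in>UNIV. f z + \<delta> z) = 1" if "\<And>x. f (- x) = - f x" for f
  proof -
    have "(\<Sum>z\<in>UNIV. f z) = (\<Sum>z\<in>UNIV. f (- z))"
      by (rule sum.reindex_bij_witness[of _ uminus uminus]) auto
    then have "(\<Sum>z\<in>UNIV. f z) = 0" by (simp add: that sum_negf)
    then show ?thesis by (simp add: sum.distrib \<delta>_def)
  qed
  have correlation_\<delta>: "(\<Sum>z\<in>UNIV. (f z + \<delta> z) * (f (z + d) + \<delta> (z + d))) = (\<Sum>z\<in>UNIV. f z * f (z + d))"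
    if odd: "\<And>x. f (- x) = - f x" and d: "d \<noteq> 0" for f d
  proof -
    have "(f z + \<delta> z) * (f (z + d) + \<delta> (z + d))
        = f z * f (z + d) + (if z = 0 then f d else 0) + (if z = - d then f (- d) else 0)" for z
    proof -
      have "z + d = 0 \<longleftrightarrow> z = - d" by (simp only: eq_neg_iff_add_eq_0)
      then show ?thesis
        using d by (cases "z = - d") (simp_all add: \<delta>_def ring_distribs)
    qed
    then show ?thesis by (simp add: sum.distrib odd)
  qed
  have zero: "a 0 = 0" "b 0 = 0" using a_odd[of 0] b_odd[of 0] by simp_all
  show ?thesis
  proof (rule skew_hadamard_mat_of_szekeres[of "\<lambda>x. a x + \<delta> x" "\<lambda>x. b x + \<delta> x"])
    show "(\<Sum>z\<in>UNIV. (a z + \<delta> z) * (a (z + d) + \<delta> (z + d)) + (b z + \<delta> z) * (b (z + d) + \<delta> (z + d))) = -2"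
      if "d \<noteq> 0" for d
      using auto[OF that] by (simp add: sum.distrib correlation_\<delta> a_odd b_odd that)
  qed (use a b zero a_odd in \<open>auto simp: \<delta>_def sum_\<delta>[unfolded \<delta>_def] a_odd b_odd\<close>)
qed

section \<open>Functions constant on cyclotomic classes of order 16\<close>

text \<open>Abstracts the field with \<open>p ^ 4 = 16 * m + 1\<close> elements, where \<open>p = 4 * c + 1\<close>, to its
  additive group: \<open>M\<close> is multiplication by a primitive element, \<open>e\<close> the unit and \<open>\<sigma>\<close> the Frobenius map.\<close>

locale primitive_frobenius =
  fixes M \<sigma> :: "'a::{ab_group_add,finite} \<Rightarrow> 'a" and e :: 'a and c m :: nat
  assumes odd_c: "odd c" and odd_m: "odd m"
    and M_add: "M (x + y) = M x + M y"
    and \<sigma>_add: "\<sigma> (x + y) = \<sigma> x + \<sigma> y"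
    and \<sigma>_e: "\<sigma> e = e"
    and \<sigma>_M: "\<sigma> (M x) = (M ^^ (4 * c + 1)) (\<sigma> x)"
    and pow_eq_iff: "(M ^^ i) e = (M ^^ j) e \<longleftrightarrow> i mod (16 * m) = j mod (16 * m)"
    and nonzero_iff: "x \<noteq> 0 \<longleftrightarrow> (\<exists>k. x = (M ^^ k) e)"
    and minus_e: "- e = (M ^^ (8 * m)) e"
begin

section \<open>The quartic character and \<open>U\<close> on powers of the generator\<close>

definition dlog :: "'a \<Rightarrow> nat" where
  "dlog x = (LEAST k. x = (M ^^ k) e)"

definition \<chi> :: "'a \<Rightarrow> complex" where
  "\<chi> x = (if x = 0 then 0 else \<i> ^ dlog x)"

definition U :: "'a \<Rightarrow> complex" where
  "U x = (if x = 0 then 0 else \<i> ^ (dlog x div 4))"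

lemma pow_nonzero [simp]: "(M ^^ k) e \<noteq> 0"
  using nonzero_iff by blast

lemma zero_cases [case_names zero pow]:
  obtains "x = 0" | k where "x = (M ^^ k) e"
  using nonzero_iff by blast

lemma i_power_mod: "\<i> ^ k = \<i> ^ (k mod 4)"
proof -
  have "\<i> ^ k = \<i> ^ (4 * (k div 4) + k mod 4)" by simp
  also have "\<dots> = \<i> ^ (k mod 4)" unfolding power_add power_mult by simp
  finally show ?thesis .
qed

lemma i_power_cong: "\<i> ^ k = \<i> ^ l" if "k mod 4 = l mod 4"
  using i_power_mod[of k] i_power_mod[of l] that by simp

lemma i_power_inj: "k mod 4 = l mod 4" if "\<i> ^ k = \<i> ^ l"
proof -
  have mod4: "j mod 4 = 0 \<or> j mod 4 = 1 \<or> j mod 4 = 2 \<or> j mod 4 = 3" for j :: nat by presburger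
  have "\<i> ^ (k mod 4) = \<i> ^ (l mod 4)"
    by (rule trans[OF sym[OF i_power_mod] trans[OF that i_power_mod]])
  then show ?thesis
    using mod4[of k] mod4[of l] by (elim disjE) (simp_all add: complex_eq_iff power3_eq_cube)
qed

lemma i_power_4: "(\<i> ^ k) ^ 4 = 1"
proof -
  have "(\<i> ^ k) ^ 4 = (\<i> ^ 4) ^ k" by (simp only: power_mult[symmetric] mult.commute)
  then show ?thesis by simp
qed

lemma dlog_pow: "dlog ((M ^^ k) e) mod 16 = k mod 16"
proof -
  have "(M ^^ k) e = (M ^^ dlog ((M ^^ k) e)) e"
    unfolding dlog_def by (rule LeastI[of "\<lambda>j. (M ^^ k) e = (M ^^ j) e" k]) (rule refl)
  then have "k mod (16 * m) = dlog ((M ^^ k) e) mod (16 * m)"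
    by (rule iffD1[OF pow_eq_iff])
  then have "k mod (16 * m) mod 16 = dlog ((M ^^ k) e) mod (16 * m) mod 16"
    by (rule arg_cong)
  then show ?thesis by (simp only: mod_mod_cancel[OF dvd_triv_left])
qed

lemma \<chi>_pow: "\<chi> ((M ^^ k) e) = \<i> ^ k"
proof -
  have "dlog ((M ^^ k) e) mod 16 mod 4 = k mod 16 mod 4"
    by (simp only: dlog_pow)
  then have "dlog ((M ^^ k) e) mod 4 = k mod 4"
    by (simp add: mod_mod_cancel)
  then show ?thesis
    by (simp only: \<chi>_def pow_nonzero if_False) (rule i_power_cong)
qed

lemma U_pow: "U ((M ^^ k) e) = \<i> ^ (k div 4)"
proof -
  have "j div 4 mod 4 = j mod 16 div 4" for j :: nat
    using mod_mult2_eq[of j 4 4] by simp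
  then have "(dlog ((M ^^ k) e) div 4) mod 4 = (k div 4) mod 4"
    by (simp only: dlog_pow)
  then show ?thesis
    by (simp only: U_def pow_nonzero if_False) (rule i_power_cong)
qed

lemma \<chi>_zero [simp]: "\<chi> 0 = 0" and U_zero [simp]: "U 0 = 0"
  by (simp_all add: \<chi>_def U_def)

lemma M_zero [simp]: "M 0 = 0" and \<sigma>_zero [simp]: "\<sigma> 0 = 0"
  using M_add[of 0 0] \<sigma>_add[of 0 0] by simp_all

lemma M_pow_zero [simp]: "(M ^^ k) 0 = 0"
  by (induction k) auto

lemma M_pow_add: "(M ^^ k) (x + y) = (M ^^ k) x + (M ^^ k) y"
  by (induction k) (auto simp: M_add)

lemma M_pow_minus: "(M ^^ k) (- x) = - (M ^^ k) x"
  using M_pow_add[of k "- x" x] by (simp add: eq_neg_iff_add_eq_0)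

lemma pow_pow: "(M ^^ j) ((M ^^ k) e) = (M ^^ (j + k)) e"
  by (simp add: funpow_add)

text \<open>\<open>U\<close> is not multiplicative, but adding \<open>4 * j\<close> to an exponent
  adds exactly \<open>j\<close> to its quotient by 4.\<close>

lemma U_M_pow_4: "U ((M ^^ (4 * j)) x) = \<i> ^ j * U x"
  by (cases x rule: zero_cases) (simp_all add: pow_pow U_pow power_add)

text \<open>The exponent of -1 is \<open>8 * m = 4 * (2 * m)\<close>, and
  \<open>\<i> ^ (2 * m) = (-1) ^ m\<close> with \<open>m\<close> odd.\<close>

lemma U_minus: "U (- x) = - U x"
proof (cases x rule: zero_cases)
  case (pow k)
  have "- x = (M ^^ (4 * (2 * m))) x"
  proof -
    have "- x = (M ^^ k) (- e)" by (simp add: pow M_pow_minus)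
    also have "\<dots> = (M ^^ (k + 8 * m)) e" unfolding minus_e pow_pow ..
    also have "\<dots> = (M ^^ (8 * m)) x" unfolding pow pow_pow by (simp only: add.commute)
    finally show ?thesis by simp
  qed
  then have "U (- x) = \<i> ^ (2 * m) * U x"
    by (simp only: U_M_pow_4)
  also have "\<i> ^ (2 * m) = -1"
    unfolding power_mult using odd_m by simp
  finally show ?thesis by simp
qed simp

lemma inj_M_pow: "inj (M ^^ k)"
proof (rule injI)
  fix x y assume "(M ^^ k) x = (M ^^ k) y"
  then have *: "(M ^^ k) (x - y) = 0" 
    using M_pow_add[of k "x - y" y] by simp
  show "x = y"
  proof (cases "x - y" rule: zero_cases)
    case (pow j)
    with * have "(M ^^ (k + j)) e = 0" by (simp only: pow_pow)
    then show ?thesis using pow_nonzero by blast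
  qed simp
qed

lemma \<sigma>_pow: "\<sigma> ((M ^^ k) e) = (M ^^ ((4 * c + 1) * k)) e"
proof (induction k)
  case (Suc k)
  have "\<sigma> ((M ^^ Suc k) e) = (M ^^ (4 * c + 1)) (\<sigma> ((M ^^ k) e))"
    by (simp only: funpow.simps comp_def \<sigma>_M)
  also have "\<dots> = (M ^^ (4 * c + 1 + (4 * c + 1) * k)) e"
    unfolding Suc pow_pow ..
  finally show ?case by (simp only: mult_Suc_right)
qed (simp add: \<sigma>_e)

lemma inj_\<sigma>: "inj \<sigma>"
proof (rule injI)
  fix x y assume "\<sigma> x = \<sigma> y"
  then have *: "\<sigma> (x - y) = 0" using \<sigma>_add[of "x - y" y] by simp
  show "x = y"
  proof (cases "x - y" rule: zero_cases)
    case (pow j)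
    with * show ?thesis by (simp only: \<sigma>_pow pow_nonzero)
  qed simp
qed

lemma bij_M_pow: "bij (M ^^ k)"
  unfolding bij_def using inj_M_pow finite_UNIV_inj_surj[OF finite] by blast

lemma \<chi>_\<sigma>: "\<chi> (\<sigma> x) = \<chi> x"
proof (cases x rule: zero_cases)
  case (pow k)
  have "((4 * c + 1) * k) mod 4 = (k + 4 * (c * k)) mod 4"
    by (simp only: distrib_right mult_1 mult.assoc add.commute)
  then have "((4 * c + 1) * k) mod 4 = k mod 4" by simp
  then show ?thesis unfolding pow \<sigma>_pow \<chi>_pow by (rule i_power_cong)
qed simp

text \<open>Frobenius raises the exponent \<open>k\<close> of \<open>x\<close> by
  \<open>4 * (k * c)\<close>; being a multiple of 4, this gives the factor
  \<open>\<i> ^ (k * c)\<close> whatever \<open>s\<close> is.\<close>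

lemma U_M_pow_\<sigma>: "U ((M ^^ s) (\<sigma> x)) = \<chi> x ^ c * U ((M ^^ s) x)"
proof (cases x rule: zero_cases)
  case (pow k)
  have "(M ^^ s) (\<sigma> x) = (M ^^ (4 * (k * c))) ((M ^^ s) x)"
    unfolding pow \<sigma>_pow pow_pow by (rule arg_cong[of _ _ "\<lambda>j. (M ^^ j) e"]) (simp add: algebra_simps)
  moreover have "\<chi> x ^ c = \<i> ^ (k * c)"
    unfolding pow \<chi>_pow power_mult ..
  ultimately show ?thesis by (simp only: U_M_pow_4)
qed simp

section \<open>Frobenius acting on the terms of the autocorrelation\<close>

definition T :: "nat \<Rightarrow> 'a \<Rightarrow> complex" where
  "T s x = U ((M ^^ s) x) * cnj (U ((M ^^ s) (x + e)))"

text \<open>\<open>T s x\<close> is a term of the autocorrelation at \<open>(M ^^ s) e\<close>;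
  \<open>w x ^ c\<close> is the factor it gains when Frobenius is applied to
  \<open>x\<close>.\<close>

definition w :: "'a \<Rightarrow> complex" where
  "w x = \<chi> x * cnj (\<chi> (x + e))"

lemma \<sigma>_add_e: "\<sigma> x + e = \<sigma> (x + e)"
  by (simp add: \<sigma>_add \<sigma>_e)

lemma w_\<sigma>: "w (\<sigma> x) = w x"
  by (simp add: w_def \<sigma>_add_e \<chi>_\<sigma>)

lemma T_\<sigma>: "T s (\<sigma> x) = w x ^ c * T s x"
  by (simp add: T_def w_def \<sigma>_add_e U_M_pow_\<sigma> power_mult_distrib mult.assoc mult.left_commute)

text \<open>The nonzero values of \<open>w\<close> are fourth roots of unity, and raising to an odd
  power permutes these.\<close>

lemma w_power_c: "w x ^ c \<noteq> 1" if "w x \<noteq> 1"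
proof (cases "x = 0 \<or> x + e = 0")
  case True
  then have "w x = 0" by (auto simp: w_def)
  then show ?thesis using odd_pos[OF odd_c] by (simp add: zero_power)
next
  case False
  then obtain k l where "x = (M ^^ k) e" "x + e = (M ^^ l) e"
    using nonzero_iff by metis
  then have "w x ^ 4 = (\<i> ^ k) ^ 4 * cnj ((\<i> ^ l) ^ 4)"
    by (simp only: w_def \<chi>_pow power_mult_distrib complex_cnj_power)
  also have "\<dots> = 1"
    by (simp only: i_power_4 complex_cnj_one mult_1)
  finally have "(w x ^ 2) ^ 2 = 1"
    by (simp flip: power_mult)
  then consider "w x ^ 2 = 1" | "w x ^ 2 = -1"
    unfolding power2_eq_1_iff by blast
  moreover obtain j where "c = 2 * j + 1" using odd_c by (rule oddE)
  then have "w x ^ c = w x * (w x ^ 2) ^ j"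
    unfolding \<open>c = 2 * j + 1\<close> power_add power_mult by (simp only: power_one_right mult.commute)
  ultimately show ?thesis
  proof cases
    case 2
    then have "w x \<noteq> - 1" by auto
    then have "- w x \<noteq> 1" by (metis minus_minus)
    with \<open>w x \<noteq> 1\<close> 2 \<open>w x ^ c = _\<close> show ?thesis by (simp add: minus_one_power_iff)
  qed (use \<open>w x \<noteq> 1\<close> in simp)
qed

text \<open>Here \<open>\<chi> x = \<chi> (x + e)\<close>, so the exponents of \<open>x\<close> and
  \<open>x + e\<close> agree modulo 4 and adding \<open>s\<close> to both affects the two factors of
  \<open>T\<close> alike.\<close>

lemma T_indep: "T s x = T 0 x" if "w x = 1"
proof -
  have w_zero: "w x = 0" if "x = 0 \<or> x + e = 0"
    using that by (auto simp: w_def)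
  have "x \<noteq> 0" "x + e \<noteq> 0"
    using \<open>w x = 1\<close> w_zero by (metis zero_neq_one)+
  then obtain k l where x: "x = (M ^^ k) e" and y: "x + e = (M ^^ l) e"
    using nonzero_iff by metis
  have kl_1: "\<i> ^ k * cnj (\<i> ^ l) = 1" using that unfolding w_def y unfolding x \<chi>_pow .
  have unit: "\<i> ^ j * cnj (\<i> ^ j) = 1" for j
    unfolding complex_norm_square[symmetric] by (simp add: norm_power)
  have "\<i> ^ k = \<i> ^ k * (\<i> ^ l * cnj (\<i> ^ l))"
    by (simp only: unit mult_1_right)
  also have "\<dots> = \<i> ^ k * cnj (\<i> ^ l) * \<i> ^ l"
    by (simp only: mult_ac)
  also have "\<dots> = \<i> ^ l"
    by (simp only: kl_1 mult_1_left)
  finally have "\<i> ^ k = \<i> ^ l" .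
  then have kl: "k mod 4 = l mod 4"
    by (rule i_power_inj)
  have "T s x = \<i> ^ (k div 4) * cnj (\<i> ^ (l div 4))" (is "?T s") for s
  proof -
    \<comment> \<open>The second factor is the carry caused by \<open>s\<close>; it depends on
      \<open>j\<close> only through \<open>j mod 4\<close>.\<close>
    have *: "U ((M ^^ s) ((M ^^ j) e)) = \<i> ^ (j div 4) * \<i> ^ ((s + j mod 4) div 4)" for j
    proof -
      have "s + j = s + j mod 4 + 4 * (j div 4)" by simp
      then have "(s + j) div 4 = j div 4 + (s + j mod 4) div 4" by (simp only: div_mult_self2)
      then show ?thesis by (simp only: pow_pow U_pow power_add)
    qed
    have "T s x = \<i> ^ (k div 4) * cnj (\<i> ^ (l div 4))
        * (\<i> ^ ((s + l mod 4) div 4) * cnj (\<i> ^ ((s + l mod 4) div 4)))"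
      unfolding T_def y unfolding x * kl by (simp only: complex_cnj_mult mult_ac)
    then show ?thesis by (simp only: unit mult_1_right)
  qed
  show ?thesis using \<open>?T s\<close> \<open>?T 0\<close> by (rule trans[OF _ sym])
qed

text \<open>Frobenius permutes each fibre of \<open>w\<close>, so the sum over it equals
  \<open>v ^ c\<close> times itself and vanishes for \<open>v \<noteq> 1\<close>; over 1 the terms
  themselves do not depend on \<open>s\<close>.\<close>

lemma sum_T_fibre: "(\<Sum>x | w x = v. T s x) = (\<Sum>x | w x = v. T 0 x)"
proof (cases "v = 1")
  case True
  then show ?thesis by (auto intro: sum.cong T_indep)
next
  case False
  have "(\<Sum>x | w x = v. T s x) = 0" for s
  proof (cases "\<exists>x. w x = v")
    case True
    have "\<sigma> ` {x. w x = v} = {x. w x = v}"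
      using inj_\<sigma> by (intro endo_inj_surj) (auto simp: w_\<sigma> inj_on_def)
    then have "(\<Sum>x | w x = v. T s x) = (\<Sum>x | w x = v. T s (\<sigma> x))"
      using sum.reindex[OF inj_on_subset[OF inj_\<sigma> subset_UNIV], of "T s" "{x. w x = v}"]
      by (simp add: comp_def)
    also have "\<dots> = v ^ c * (\<Sum>x | w x = v. T s x)"
      by (simp add: T_\<sigma> sum_distrib_left)
    finally show ?thesis using w_power_c True False by auto
  qed simp
  then show ?thesis by simp
qed

lemma sum_T: "(\<Sum>x\<in>UNIV. T s x) = (\<Sum>x\<in>UNIV. T 0 x)"
proof -
  have "(\<Sum>x\<in>UNIV. T s x) = (\<Sum>v\<in>range w. \<Sum>x | w x = v. T s x)" for s
    using sum.group[of UNIV "range w" w "T s"] by simp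
  from this[of s] this[of 0] show ?thesis by (simp only: sum_T_fibre[of s])
qed

section \<open>Constancy and value of the autocorrelation\<close>

definition C :: "'a \<Rightarrow> complex" where
  "C d = (\<Sum>z\<in>UNIV. U z * cnj (U (z + d)))"

lemma C_pow: "C ((M ^^ s) e) = C e"
proof -
  have "C ((M ^^ s) e) = (\<Sum>x\<in>UNIV. T s x)" for s
    unfolding C_def T_def M_pow_add
    using sum.reindex_bij_betw[OF bij_M_pow, of "\<lambda>z. U z * cnj (U (z + (M ^^ s) e))"] by simp
  from this[of s] this[of 0] show ?thesis using sum_T[of s] by simp
qed

lemma sum_U: "(\<Sum>x\<in>UNIV. U x) = 0"
proof -
  have "(\<Sum>x\<in>UNIV. U x) = (\<Sum>x\<in>UNIV. U (- x))"
    by (rule sum.reindex_bij_witness[of _ uminus uminus]) auto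
  then show ?thesis by (simp add: U_minus sum_negf)
qed

lemma U_norm: "U x * cnj (U x) = (if x = 0 then 0 else 1)"
  unfolding complex_norm_square[symmetric] by (simp add: U_def norm_power)

lemma C_nonzero: "C d = -1" if "d \<noteq> 0"
proof -
  let ?N = "CARD('a) - 1"
  have C_e: "C d = C e" if "d \<noteq> 0" for d
    using that nonzero_iff C_pow by metis
  have "(\<Sum>d\<in>UNIV. cnj (U (z + d))) = 0" for z
    using sum_UNIV_translate[of U z] sum_U by (simp add: add.commute flip: cnj_sum)
  \<comment> \<open>Exchanging the sums factors out the vanishing inner sum over
    \<open>d\<close>.\<close>
  then have "(\<Sum>d\<in>UNIV. C d) = 0"
    unfolding C_def by (subst sum.swap) (simp flip: sum_distrib_left)
  then have "C 0 + (\<Sum>d\<in>UNIV - {0}. C d) = 0"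
    by (simp add: sum.remove[of UNIV 0])
  moreover have "C 0 = of_nat ?N"
    unfolding C_def by (simp add: U_norm sum.If_cases Compl_eq_Diff_UNIV card_Diff_singleton)
  moreover have "(\<Sum>d\<in>UNIV - {0}. C d) = of_nat ?N * C e"
    using C_e by simp
  ultimately have "of_nat ?N * (C e + 1) = 0" by (simp add: algebra_simps)
  moreover have "?N \<noteq> 0"
    using card_mono[of UNIV "{0, e}"] pow_nonzero[of 0] by simp
  ultimately show ?thesis using C_e[OF that]
    by (auto simp: eq_neg_iff_add_eq_0 simp del: of_nat_diff)
qed

theorem ex_skew_hadamard_mat: "\<exists>H. skew_hadamard_mat (2 * (CARD('a) + 1)) H"
proof -
  define a :: "'a \<Rightarrow> int" where
    "a x = (if x = 0 then 0 else if U x = 1 \<or> U x = - \<i> then 1 else -1)" for x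
  define b :: "'a \<Rightarrow> int" where
    "b x = (if x = 0 then 0 else if U x = 1 \<or> U x = \<i> then 1 else -1)" for x
  have U_values: "U x = 1 \<or> U x = \<i> \<or> U x = -1 \<or> U x = - \<i>" if "x \<noteq> 0" for x
  proof -
    have "U x = \<i> ^ (dlog x div 4 mod 4)"
      using that by (simp only: U_def if_False i_power_mod[symmetric])
    moreover have "j mod 4 = 0 \<or> j mod 4 = 1 \<or> j mod 4 = 2 \<or> j mod 4 = 3" for j :: nat
      by presburger
    note this[of "dlog x div 4"]
    ultimately show ?thesis by (elim disjE) (simp_all add: power3_eq_cube)
  qed
  have a: "of_int (a x) = Re (U x) - Im (U x)" and b: "of_int (b x) = Re (U x) + Im (U x)" for x
    using U_values[of x] by (cases "x = 0"; auto simp: a_def b_def complex_eq_iff)+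
  show ?thesis
  proof (rule skew_hadamard_mat_of_odd_pair[of a b])
    fix x
    have "real_of_int (a (- x)) = real_of_int (- a x)" "real_of_int (b (- x)) = real_of_int (- b x)"
      by (simp_all add: a b U_minus)
    then show "a (- x) = - a x" "b (- x) = - b x" by (simp_all only: of_int_eq_iff)
  next
    fix d :: 'a assume "d \<noteq> 0"
    \<comment> \<open>The cross terms cancel: \<open>(r - s) * (r' - s') + (r + s) * (r' + s') = 2 *
      (r * r' + s * s')\<close>.\<close>
    have "real_of_int (\<Sum>z\<in>UNIV. a z * a (z + d) + b z * b (z + d)) = 2 * Re (C d)"
      unfolding C_def of_int_sum Re_sum sum_distrib_left
      by (rule sum.cong) (simp_all add: a b algebra_simps)
    then have "real_of_int (\<Sum>z\<in>UNIV. a z * a (z + d) + b z * b (z + d)) = real_of_int (-2)"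
      by (simp add: C_nonzero[OF \<open>d \<noteq> 0\<close>])
    then show "(\<Sum>z\<in>UNIV. a z * a (z + d) + b z * b (z + d)) = -2"
      by (simp only: of_int_eq_iff)
  qed (auto simp: a_def b_def)
qed

end

section \<open>The field with 625 elements\<close>

text \<open>Coordinates with respect to the powers of a root \<open>\<xi>\<close> of the primitive polynomial
  \<open>X ^ 4 - X ^ 2 - X - 2\<close> over the field with five elements.\<close>

type_synonym gf625 = "5 \<times> 5 \<times> 5 \<times> 5"

fun mult_root :: "gf625 \<Rightarrow> gf625" where
  "mult_root (a, b, c, d) = (2 * d, a + d, b + d, c)"

text \<open>The coefficients come from \<open>\<xi> ^ 5\<close>, \<open>\<xi> ^ 10\<close> and \<open>\<xi> ^ 15\<close>.\<close>

fun frobenius :: "gf625 \<Rightarrow> gf625" where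
  "frobenius (a, b, c, d) = (a + 2 * c, 2 * b + d, b + 4 * c + 2 * d, b + 2 * c + 3 * d)"

abbreviation one625 :: gf625 where
  "one625 \<equiv> (1, 0, 0, 0)"

section \<open>The multiplicative order of \<xi>\<close>

lemma five_reduce: "(5::5) = 0" "(6::5) = 1" "(7::5) = 2" "(8::5) = 3"
  "(10::5) = 0" "(15::5) = 0" "(20::5) = 0" "(25::5) = 0"
  by simp_all

text \<open>Applying \<open>f\<close> to the argument first lets the simplifier evaluate the
  coordinates after every step.\<close>

lemma funpow_numeral_step: "(f ^^ numeral k) x = (f ^^ pred_numeral k) (f x)"
  by (simp add: numeral_eq_Suc funpow_swap1)

text \<open>The exponents are 624/13, 624/3 and 624/2 for the prime divisors of
  \<open>624 = 2 ^ 4 * 3 * 13\<close>; none of these powers is 1, and the last one is -1.\<close>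

lemma mult_root_48: "(mult_root ^^ 48) one625 = (4, 3, 0, 1)"
  and mult_root_208: "(mult_root ^^ 208) one625 = (0, 4, 2, 3)"
  and mult_root_312: "(mult_root ^^ 312) one625 = - one625"
  by (simp_all add: funpow_numeral_step five_reduce)

lemma mult_root_add: "mult_root (x + y) = mult_root x + mult_root y"
  by (cases x; cases y) (simp add: algebra_simps)

lemma mult_root_minus: "mult_root (- x) = - mult_root x"
  by (cases x) simp

lemma mult_root_pow_minus: "(mult_root ^^ k) (- x) = - (mult_root ^^ k) x"
  by (induction k) (simp_all add: mult_root_minus)

lemma frobenius_mult_root: "frobenius (mult_root x) = (mult_root ^^ 5) (frobenius x)"
  by (cases x) (simp add: funpow_numeral_step, simp add: algebra_simps five_reduce)

lemma mult_root_624: "(mult_root ^^ 624) one625 = one625"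
proof -
  have "(mult_root ^^ (312 + 312)) one625 = one625"
    unfolding funpow_add comp_apply mult_root_312 mult_root_pow_minus by simp
  then show ?thesis by simp
qed

lemma funpow_mult_fixed: "(f ^^ (k * j)) x = x" if "(f ^^ k) x = x"
  by (induction j) (simp_all add: funpow_add that)

text \<open>A proper divisor of 624 divides \<open>624 / p\<close> for some prime \<open>p\<close>
  among 2, 3 and 13, where the power is known to differ from the unit.\<close>

lemma mult_root_order:
  assumes "(mult_root ^^ k) one625 = one625"
  shows "624 dvd k"
proof (rule ccontr)
  assume "\<not> 624 dvd k"
  then have "k \<noteq> 0" by (metis dvd_0_right)
  let ?d = "gcd k 624"
  \<comment> \<open>Bezout over the naturals shows that the exponent \<open>gcd k 624\<close> also
    fixes the unit.\<close>
  obtain x y where xy: "k * x = 624 * y + ?d"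
    using bezout_nat[OF \<open>k \<noteq> 0\<close>] by blast
  have "one625 = (mult_root ^^ (?d + 624 * y)) one625"
    using funpow_mult_fixed[OF assms, of x] unfolding xy by (simp only: add.commute)
  also have "\<dots> = (mult_root ^^ ?d) one625"
    unfolding funpow_add comp_apply funpow_mult_fixed[OF mult_root_624] ..
  finally have d: "(mult_root ^^ ?d) one625 = one625" by (rule sym)
  obtain q where q: "624 = ?d * q" using gcd_dvd2 by (rule dvdE)
  have "q \<noteq> 1"
  proof
    assume "q = 1"
    then have "624 = gcd k 624" using q by simp
    then show False using \<open>\<not> 624 dvd k\<close> by (metis gcd_dvd1)
  qed
  then obtain p where p: "prime p" "p dvd q" using prime_factor_nat by blast
  then obtain r where "q = p * r" by (auto elim: dvdE)
  with q have r: "624 = p * (?d * r)" by (simp only: mult.left_commute)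
  have "p dvd 2 ^ 4 * (3 * 13)"
    using dvd_triv_left[of p "?d * r"] unfolding r[symmetric] by simp
  then have "p dvd 2 \<or> p dvd 3 \<or> p dvd 13"
    using p(1) prime_dvd_power by (auto simp only: prime_dvd_mult_iff)
  then have "p = 2 \<or> p = 3 \<or> p = 13"
    using p(1) by (auto intro: primes_dvd_imp_eq)
  then have "312 = ?d * r \<or> 208 = ?d * r \<or> 48 = ?d * r"
    using r by (elim disjE) (simp_all only:, linarith+)
  moreover have "(mult_root ^^ j) one625 = one625" if "j = ?d * r" for j
    unfolding that by (rule funpow_mult_fixed[OF d])
  ultimately have "- one625 = one625 \<or> (0, 4, 2, 3) = one625 \<or> (4, 3, 0, 1) = one625"
    unfolding mult_root_312[symmetric] mult_root_208[symmetric] mult_root_48[symmetric] by blast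
  then show False by simp
qed

lemma mult_root_pow_eq_iff:
  "(mult_root ^^ i) one625 = (mult_root ^^ j) one625 \<longleftrightarrow> i mod 624 = j mod 624"
proof -
  let ?P = "\<lambda>k. (mult_root ^^ k) one625"
  have P_mod: "?P k = ?P (k mod 624)" for k
  proof -
    have "?P k = ?P (k mod 624 + 624 * (k div 624))" by simp
    then show ?thesis
      unfolding funpow_add comp_apply funpow_mult_fixed[OF mult_root_624] .
  qed
  have less: False if "?P i = ?P j" "i < j" "j < 624" for i j
  proof -
    \<comment> \<open>Shifting both exponents by \<open>624 - j\<close> gives the unit at an
      exponent strictly between 0 and 624.\<close>
    have "?P (624 - j + i) = ?P (624 - j + j)"
      unfolding funpow_add comp_apply that(1) ..
    also have "\<dots> = one625" using that mult_root_624 by simp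
    finally have "624 dvd 624 - j + i" by (rule mult_root_order)
    then show False using that by (auto dest!: dvd_imp_le)
  qed
  have "i mod 624 = j mod 624" if "?P i = ?P j"
    using that less[of "i mod 624" "j mod 624"] less[of "j mod 624" "i mod 624"]
      P_mod[of i] P_mod[of j] by (metis linorder_neqE_nat mod_less_divisor zero_less_numeral)
  then show ?thesis using P_mod by metis
qed

lemma mult_root_pow_zero: "(mult_root ^^ k) 0 = 0"
  by (induction k) (simp_all add: zero_prod_def)

text \<open>By counting: the 624 distinct powers are nonzero, hence exhaust the
  \<open>5 ^ 4 - 1\<close> nonzero elements.\<close>

lemma mult_root_primitive: "x \<noteq> 0 \<longleftrightarrow> (\<exists>k. x = (mult_root ^^ k) one625)"
proof -
  let ?P = "\<lambda>k. (mult_root ^^ k) one625"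
  have nonzero: "?P k \<noteq> 0" for k
  proof
    assume "?P k = 0"
    \<comment> \<open>Another \<open>623 * k\<close> steps keep 0 at 0, yet complete
      \<open>k\<close> full cycles back to the unit.\<close>
    then have "?P (623 * k + k) = 0"
      by (simp only: funpow_add comp_apply mult_root_pow_zero)
    moreover have "623 * k + k = 624 * k" by simp
    ultimately have "one625 = 0"
      by (simp only: funpow_mult_fixed[OF mult_root_624])
    then show False by (simp add: zero_prod_def)
  qed
  have "inj_on ?P {..<624}"
    by (rule inj_onI) (simp only: mult_root_pow_eq_iff mod_less lessThan_iff)
  then have "card (?P ` {..<624}) = 624" by (simp only: card_image card_lessThan)
  moreover have "card (UNIV - {0 :: gf625}) = 624" by (simp add: card_Diff_singleton)
  moreover have "?P ` {..<624} \<subseteq> UNIV - {0}"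
    by (rule image_subsetI) (simp only: Diff_iff UNIV_I singleton_iff nonzero simp_thms)
  ultimately have "?P ` {..<624} = UNIV - {0}"
    by (intro card_subset_eq) (simp_all only: finite)
  then have "x \<in> ?P ` {..<624} \<longleftrightarrow> x \<noteq> 0" by (simp only: Diff_iff UNIV_I singleton_iff simp_thms)
  then show ?thesis
  proof (intro iffI)
    assume "\<exists>k. x = ?P k"
    then show "x \<noteq> 0" by (elim exE) (simp only: nonzero not_False_eq_True)
  qed (auto simp only: image_iff)
qed

text \<open>The parameters are the odd numbers 1 and 39 in \<open>5 = 4 * 1 + 1\<close> and
  \<open>625 = 16 * 39 + 1\<close>.\<close>

lemma primitive_frobenius_625: "primitive_frobenius mult_root frobenius one625 1 39"
proof (unfold_locales, goal_cases)
  case (4 x y)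
  show ?case by (cases x; cases y) (simp add: algebra_simps)
next
  case (6 x)
  show ?case using frobenius_mult_root[of x] by simp
next
  case (7 i j)
  show ?case using mult_root_pow_eq_iff[of i j] by simp
next
  case (8 x)
  show ?case by (rule mult_root_primitive)
next
  case 9
  have "8 * 39 = (312 :: nat)" by simp
  then show ?case by (simp only: mult_root_312)
qed (simp_all add: mult_root_add)

theorem theorem3p2:
  shows "(1252 :: nat) = 2 * (5 ^ 4 + 1) \<and> (\<exists>H. skew_hadamard_mat 1252 H)"
  using primitive_frobenius.ex_skew_hadamard_mat[OF primitive_frobenius_625] by simp

end
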